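(* Let $g(p)$ denote the length of the shortest squarefree word over a ternary alphabet having exactly $p$ nontrivial periods. Then for every $p\ge3$, $g(p) \leq \frac{17}{12}4^{p-1} + \frac13$.
   Context: A square is a nonempty word of the form $xx$; a word is squarefree if none of its factors is a square. For a finite nonempty word $w$, an integer $p$ with $1\le p\le|w|$ is a period if $w[i]=w[i+p]$ for $1\le i\le |w|-p$; it is nontrivial if $p<|w|$. *)

theory Defs
  imports Complex_Main "HOL-Library.Sublist"
begin

definition square_word :: "'a list \<Rightarrow> bool" where
  "square_word w \<longleftrightarrow> (\<exists>x. x \<noteq> [] \<and> w = x @ x)"

text \<open>Factors are contiguous, i.e. they are the sublists in the sense of \<^const>\<open>sublist\<close>.\<close>

definition squarefree_word :: "'a list \<Rightarrow> bool" where
  "squarefree_word w \<longleftrightarrow> (\<forall>u. sublist u w \<longrightarrow> \<not> square_word u)"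

text \<open>Positions are counted from 0, so the range of \<open>i\<close> is \<open>0 \<le> i < |w| - p\<close>.\<close>

definition is_period :: "'a list \<Rightarrow> nat \<Rightarrow> bool" where
  "is_period w p \<longleftrightarrow> 1 \<le> p \<and> p \<le> length w \<and> (\<forall>i. i + p < length w \<longrightarrow> w ! i = w ! (i + p))"

definition nontrivial_periods :: "'a list \<Rightarrow> nat set" where
  "nontrivial_periods w = {p. is_period w p \<and> p < length w}"

definition squarefree_words_with_periods :: "'a set \<Rightarrow> nat \<Rightarrow> 'a list set" where
  "squarefree_words_with_periods A p =
     {w. w \<noteq> [] \<and> w \<in> lists A \<and> squarefree_word w \<and> card (nontrivial_periods w) = p}"

text \<open>The value is meaningful only if \<open>squarefree_words_with_periods A p\<close> is nonempty, as
  \<open>Least\<close> is otherwise unspecified.\<close>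

definition g :: "'a set \<Rightarrow> nat \<Rightarrow> nat" where
  "g A p = (LEAST n. \<exists>w \<in> squarefree_words_with_periods A p. length w = n)"

end

theory Submission
  imports Defs
begin

text \<open>
  Nontrivial periods of \<open>w\<close> correspond to its borders. The longest border of \<open>w\<close> has exactly one
  border fewer than \<open>w\<close>, so it suffices to find short squarefree words with at least \<open>p\<close> borders.
  Leech's 13-uniform morphism preserves squarefreeness: windows of length 8 in an image determine
  their position modulo 13, so the period of a long square is a multiple of 13, and reading off
  the last letter of each block yields a square in the preimage. The image of a word that begins
  and ends with the same letter \<open>a\<close> has all images of the old borders as borders, and the
  two borders (of lengths 1 and 5) of the image of \<open>a\<close> in addition. Since \<open>13 < 4\<^sup>2\<close>, the bound for
  \<open>p\<close> implies the one for \<open>p + 2\<close>, and the induction starts from a word of length 23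
  with 3 borders and the image of \<open>XYXZXYX\<close>, which has length 91 and 4 borders.
\<close>

section \<open>Squarefree words\<close>

lemma squarefree_word_iff_append:
  "squarefree_word w \<longleftrightarrow> (\<forall>ps x ss. w = ps @ x @ x @ ss \<longrightarrow> x = [])"
  by (simp add: squarefree_word_def square_word_def sublist_def) (metis append_assoc)

lemma squarefree_word_code [code]:
  "squarefree_word [] \<longleftrightarrow> True"
  "squarefree_word (a # w) \<longleftrightarrow>
     squarefree_word w \<and> list_all (\<lambda>x. x = [] \<or> \<not> prefix (x @ x) (a # w)) (prefixes (a # w))"
proof -
  show "squarefree_word [] \<longleftrightarrow> True"
    by (simp add: squarefree_word_iff_append)
  have "(\<forall>u. prefix u (a # w) \<longrightarrow> \<not> square_word u) \<longleftrightarrow>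
      (\<forall>x. prefix x (a # w) \<longrightarrow> x = [] \<or> \<not> prefix (x @ x) (a # w))"
    unfolding square_word_def using append_prefixD by metis
  then show "squarefree_word (a # w) \<longleftrightarrow>
     squarefree_word w \<and> list_all (\<lambda>x. x = [] \<or> \<not> prefix (x @ x) (a # w)) (prefixes (a # w))"
    by (auto simp: squarefree_word_def sublist_Cons_right list_all_iff simp del: prefixes.simps)
qed

lemma squarefree_word_sublist: "squarefree_word w \<Longrightarrow> sublist v w \<Longrightarrow> squarefree_word v"
  unfolding squarefree_word_def by (meson sublist_order.order.trans)

lemma squarefree_word_take_drop: "squarefree_word w \<Longrightarrow> squarefree_word (take k (drop i w))"
  by (meson squarefree_word_sublist sublist_drop sublist_take)

lemma squarefree_word_map:
  assumes "inj_on f (set w)" and "squarefree_word w"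
  shows "squarefree_word (map f w)"
  unfolding squarefree_word_iff_append
proof (intro allI impI)
  fix ps x ss
  assume "map f w = ps @ x @ x @ ss"
  then obtain ps' y z ss' where w: "w = ps' @ y @ z @ ss'" and "map f y = x" "map f z = x"
    by (auto simp: map_eq_append_conv append_eq_map_conv)
  moreover have "inj_on f (set y \<union> set z)"
    using assms(1) by (rule inj_on_subset) (auto simp: w)
  ultimately have "y = z"
    by (metis inj_on_map_eq_map)
  then show "x = []"
    using assms(2) w \<open>map f y = x\<close> by (auto simp: squarefree_word_iff_append)
qed

lemma not_squarefree_word_if_nth_eq:
  assumes "0 < q" and "s + 2 * q \<le> length w"
    and "\<And>j. j < q \<Longrightarrow> w ! (s + j) = w ! (s + q + j)"
  shows "\<not> squarefree_word w"
proof -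
  define x where "x = take q (drop s w)"
  have "take q (drop (s + q) w) = x"
    unfolding x_def using assms(2) by (intro nth_equalityI) (simp_all flip: assms(3))
  moreover have "w = take s w @ take q (drop s w) @ take q (drop (s + q) w) @ drop (s + q + q) w"
    by (metis add.commute append_take_drop_id drop_drop)
  ultimately have "w = take s w @ x @ x @ drop (s + q + q) w"
    by (simp add: x_def)
  moreover have "x \<noteq> []"
    using assms(1,2) by (simp add: x_def)
  ultimately show ?thesis
    unfolding squarefree_word_iff_append by blast
qed

section \<open>Borders\<close>

definition borders :: "'a list \<Rightarrow> nat set" where
  "borders w = {k. 0 < k \<and> k < length w \<and> take k w = drop (length w - k) w}"

lemma borders_code [code]:
  "borders w = set (filter (\<lambda>k. take k w = drop (length w - k) w) [1..<length w])"
  by (auto simp: borders_def)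

lemma finite_borders [simp]: "finite (borders w)"
  by (simp add: borders_code)

lemma borders_map:
  assumes "inj_on f (set w)"
  shows "borders (map f w) = borders w"
proof -
  have "map f (take k w) = map f (drop l w) \<longleftrightarrow> take k w = drop l w" for k l
    using assms by (intro inj_on_map_eq_map inj_on_subset[OF assms])
      (auto dest: in_set_takeD in_set_dropD)
  then show ?thesis
    by (simp add: borders_def take_map drop_map)
qed

lemma card_nontrivial_periods: "card (nontrivial_periods w) = card (borders w)"
proof -
  have is_period_iff:
    "is_period w p \<longleftrightarrow> 1 \<le> p \<and> p \<le> length w \<and> take (length w - p) w = drop p w" for p
    by (auto simp: is_period_def list_eq_iff_nth_eq add.commute)
  have "bij_betw (\<lambda>k. length w - k) (borders w) (nontrivial_periods w)"
    by (rule bij_betw_byWitness[where f' = "\<lambda>k. length w - k"])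
      (auto simp: borders_def nontrivial_periods_def is_period_iff)
  then show ?thesis
    by (simp add: bij_betw_same_card)
qed

lemma borders_take_border:
  assumes "k \<in> borders w"
  shows "borders (take k w) = {j \<in> borders w. j < k}"
proof -
  have k: "k < length w" "take k w = drop (length w - k) w"
    using assms by (auto simp: borders_def)
  have "drop (k - j) (take k w) = drop (length w - j) w" if "j < k" for j
    using k that by simp
  then show ?thesis
    using k(1) by (auto simp: borders_def min_def)
qed

lemma borders_take_Max_borders:
  assumes "borders w \<noteq> {}"
  shows "borders (take (Max (borders w)) w) = borders w - {Max (borders w)}"
proof -
  define k where "k = Max (borders w)"
  have "k \<in> borders w" and "\<And>j. j \<in> borders w \<Longrightarrow> j \<le> k"
    using assms by (simp_all add: k_def)
  then have "borders (take k w) = borders w - {k}"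
    using assms by (auto simp: borders_take_border le_less)
  then show ?thesis
    by (simp only: k_def)
qed

lemma exists_prefix_with_card_borders:
  assumes "w \<noteq> []" and "p \<le> card (borders w)"
  shows "\<exists>v. prefix v w \<and> v \<noteq> [] \<and> card (borders v) = p"
  using assms
proof (induction w rule: measure_induct_rule[of length])
  case (less w)
  show ?case
  proof (cases "card (borders w) = p")
    case True
    then show ?thesis
      using less.prems by blast
  next
    case False
    define u where "u = take (Max (borders w)) w"
    have "borders w \<noteq> {}"
      using False less.prems by auto
    then have "Max (borders w) \<in> borders w"
      by (intro Max_in) simp_all
    then have "0 < Max (borders w)" "Max (borders w) < length w"
      by (simp_all only: borders_def mem_Collect_eq)
    then have "length u < length w" "u \<noteq> []"
      by (auto simp: u_def)
    moreover have "p \<le> card (borders u)"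
      using False less.prems \<open>borders w \<noteq> {}\<close> by (simp add: u_def borders_take_Max_borders)
    ultimately obtain v where "prefix v u" "v \<noteq> []" "card (borders v) = p"
      using less.IH by blast
    then show ?thesis
      unfolding u_def using prefix_order.trans take_is_prefix by blast
  qed
qed

lemma map_in_squarefree_words_with_periods:
  assumes "inj_on f A" and "w \<in> squarefree_words_with_periods A p"
  shows "map f w \<in> squarefree_words_with_periods (f ` A) p"
proof -
  have "w \<in> lists A"
    using assms(2) by (simp add: squarefree_words_with_periods_def)
  then have "inj_on f (set w)"
    by (intro inj_on_subset[OF assms(1)]) auto
  then show ?thesis
    using assms(2)
    by (auto simp: squarefree_words_with_periods_def card_nontrivial_periods
        borders_map squarefree_word_map)
qed

lemma g_le_length: "w \<in> squarefree_words_with_periods A p \<Longrightarrow> g A p \<le> length w"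
  unfolding g_def by (intro Least_le) blast

lemma exists_word_with_periods_if_many_borders:
  assumes "w \<noteq> []" "w \<in> lists A" "squarefree_word w" "p \<le> card (borders w)"
  shows "\<exists>v \<in> squarefree_words_with_periods A p. length v \<le> length w"
proof -
  obtain v where v: "prefix v w" "v \<noteq> []" "card (borders v) = p"
    using exists_prefix_with_card_borders assms(1,4) by blast
  moreover have "v \<in> lists A"
    using assms(2) set_mono_prefix[OF v(1)] by auto
  moreover have "squarefree_word v"
    using assms(3) v(1) by (blast intro: squarefree_word_sublist)
  ultimately show ?thesis
    by (auto simp: squarefree_words_with_periods_def card_nontrivial_periods
        dest: prefix_length_le)
qed

section \<open>Uniform morphisms\<close>

locale uniform_morphism =
  fixes h :: "'a \<Rightarrow> 'b list" and n :: nat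
  assumes length_block [simp]: "length (h a) = n"
    and block_nonempty: "0 < n"
begin

abbreviation morph :: "'a list \<Rightarrow> 'b list" where
  "morph w \<equiv> concat (map h w)"

lemma length_morph [simp]: "length (morph w) = n * length w"
  by (induction w) simp_all

lemma take_morph: "take (n * k) (morph w) = morph (take k w)"
proof (induction w arbitrary: k)
  case (Cons a w)
  then show ?case
    by (cases k) simp_all
qed simp

lemma drop_morph: "drop (n * k) (morph w) = morph (drop k w)"
proof (induction w arbitrary: k)
  case (Cons a w)
  then show ?case
    by (cases k) simp_all
qed simp

lemma nth_morph_block_end:
  assumes "t < length w"
  shows "morph w ! (n * t + (n - 1)) = last (h (w ! t))"
proof -
  have "morph w ! (n * t + (n - 1)) = drop (n * t) (morph w) ! (n - 1)"
    using assms by simp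
  also have "\<dots> = (h (w ! t) @ morph (drop (Suc t) w)) ! (n - 1)"
    using assms by (simp add: drop_morph flip: Cons_nth_drop_Suc)
  also have "\<dots> = last (h (w ! t))"
    using block_nonempty by (simp add: nth_append last_conv_nth flip: length_greater_0_conv)
  finally show ?thesis .
qed

text \<open>A window of length at most \<open>n + 1\<close> meets at most two blocks, so the images of the words of
  length at most two contain every window of that length.\<close>

definition occurs_at_phase :: "nat \<Rightarrow> 'b list \<Rightarrow> bool" where
  "occurs_at_phase r x \<longleftrightarrow>
     r < n \<and> (\<exists>u. squarefree_word u \<and> length u \<le> 2 \<and> prefix x (drop r (morph u)))"

definition synchronizing :: "nat \<Rightarrow> bool" where
  "synchronizing l \<longleftrightarrow>
     (\<forall>x r s. length x = l \<and> occurs_at_phase r x \<and> occurs_at_phase s x \<longrightarrow> r = s)"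

lemma occurs_at_phase_if_short:
  assumes "squarefree_word w" "prefix x (drop i (morph w))" "i mod n + length x \<le> 2 * n"
  shows "occurs_at_phase (i mod n) x"
proof -
  define u where "u = take 2 (drop (i div n) w)"
  have "drop i (morph w) = drop (i mod n) (drop (n * (i div n)) (morph w))"
    by simp
  then have "prefix x (drop (i mod n) (morph (drop (i div n) w)))"
    using assms(2) by (simp only: drop_morph)
  then have "prefix x (take (2 * n - i mod n) (drop (i mod n) (morph (drop (i div n) w))))"
    using assms(3) by (auto simp: prefix_def)
  also have "\<dots> = drop (i mod n) (take (n * 2) (morph (drop (i div n) w)))"
    using assms(3) by (simp add: take_drop mult.commute)
  also have "\<dots> = drop (i mod n) (morph u)"
    by (simp only: take_morph u_def)
  finally have "prefix x (drop (i mod n) (morph u))" .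
  moreover have "squarefree_word u" "length u \<le> 2"
    using assms(1) by (simp_all add: u_def squarefree_word_take_drop)
  ultimately show ?thesis
    using block_nonempty by (auto simp: occurs_at_phase_def)
qed

lemma nth_eq_if_morph_nth_block_end_eq:
  assumes "inj (\<lambda>a. last (h a))" and "t < length w" "t' < length w"
    and "morph w ! (n * t + (n - 1)) = morph w ! (n * t' + (n - 1))"
  shows "w ! t = w ! t'"
  using assms(2-4) by (simp only: nth_morph_block_end injD[OF assms(1)])

lemma not_squarefree_word_if_morph_square_dvd:
  assumes marked: "inj (\<lambda>a. last (h a))"
    and square: "morph w = ps @ x @ x @ ss" "x \<noteq> []" and dvd: "n dvd length x"
  shows "\<not> squarefree_word w"
proof -
  obtain q where q: "length x = n * q"
    using dvd by blast
  have len: "length ps + n * (2 * q) \<le> n * length w"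
    using arg_cong[OF square(1), of length] q by simp
  define s where "s = length ps div n"
  have "length ps = n * s + length ps mod n" "length ps mod n < n"
    using block_nonempty by (simp_all add: s_def)
  then have s: "n * s \<le> length ps" "length ps \<le> n * s + (n - 1)"
    by linarith+
  show ?thesis
  proof (rule not_squarefree_word_if_nth_eq)
    show "0 < q"
      using square(2) q by (cases q) simp_all
    have "n * (s + 2 * q) \<le> n * length w"
      using s(1) len by (simp add: algebra_simps)
    then show "s + 2 * q \<le> length w"
      using block_nonempty by simp
    fix j
    assume "j < q"
    define k where "k = n * (s + j) + (n - 1) - length ps"
    have "n * j + n \<le> n * q"
      using \<open>j < q\<close> mult_le_mono2[of "Suc j" q n] by simp
    then have k: "length ps + k = n * (s + j) + (n - 1)"
      "length ps + length x + k = n * (s + q + j) + (n - 1)" "k < length x"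
      using s q block_nonempty by (auto simp: k_def algebra_simps)
    have "morph w ! (length ps + k) = morph w ! (length ps + length x + k)"
      using k(3) by (simp add: square(1) nth_append)
    then show "w ! (s + j) = w ! (s + q + j)"
      unfolding k using \<open>j < q\<close> \<open>s + 2 * q \<le> length w\<close>
      by (intro nth_eq_if_morph_nth_block_end_eq[OF marked]) simp_all
  qed
qed

lemma square_in_image_of_short_word:
  assumes "squarefree_word w" and "morph w = ps @ x @ x @ ss" and "2 * length x \<le> n + 1"
  shows "\<exists>u. squarefree_word u \<and> length u \<le> 2 \<and> sublist (x @ x) (morph u)"
proof -
  have "prefix (x @ x) (drop (length ps) (morph w))"
    by (simp add: assms(2) prefix_def)
  moreover have "length ps mod n < n"
    using block_nonempty by simp
  ultimately have "occurs_at_phase (length ps mod n) (x @ x)"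
    using assms(1,3) by (intro occurs_at_phase_if_short) simp_all
  then obtain u where "squarefree_word u" "length u \<le> 2"
    and "prefix (x @ x) (drop (length ps mod n) (morph u))"
    by (auto simp: occurs_at_phase_def)
  then show ?thesis
    by (meson prefix_imp_sublist sublist_drop sublist_order.order.trans)
qed

lemma dvd_length_if_synchronizing:
  assumes "synchronizing l" and "l \<le> n + 1" and "squarefree_word w"
    and "morph w = ps @ x @ x @ ss" and "l \<le> length x"
  shows "n dvd length x"
proof -
  have phase: "occurs_at_phase (k mod n) (take l x)"
    if "prefix (take l x) (drop k (morph w))" for k
  proof -
    have "k mod n < n"
      using block_nonempty by simp
    then show ?thesis
      using assms(2,3,5) that by (intro occurs_at_phase_if_short) simp_all
  qed
  have "occurs_at_phase (length ps mod n) (take l x)"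
    "occurs_at_phase ((length ps + length x) mod n) (take l x)"
    by (rule phase, simp add: assms(4) take_is_prefix)+
  moreover have "length (take l x) = l"
    using assms(5) by simp
  ultimately have "length ps mod n = (length ps + length x) mod n"
    using assms(1) unfolding synchronizing_def by blast
  then show ?thesis
    using mod_eq_dvd_iff_nat[of "length ps" "length ps + length x" n] by simp
qed

text \<open>The bound on \<open>l\<close> lets a window of length \<open>l\<close>, and also a square of period less than \<open>l\<close>, that
  starts anywhere in a block end within the next block.\<close>

theorem squarefree_word_morph:
  assumes sync: "synchronizing l" "2 * l \<le> n + 3"
    and marked: "inj (\<lambda>a. last (h a))"
    and short: "\<And>u. squarefree_word u \<Longrightarrow> length u \<le> 2 \<Longrightarrow> squarefree_word (morph u)"
    and sf: "squarefree_word w"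
  shows "squarefree_word (morph w)"
  unfolding squarefree_word_iff_append
proof (intro allI impI, rule ccontr)
  fix ps x ss
  assume square: "morph w = ps @ x @ x @ ss" and "x \<noteq> []"
  show False
  proof (cases "length x < l")
    case True
    then have "2 * length x \<le> n + 1"
      using sync(2) by linarith
    then obtain u where "squarefree_word (morph u)" "sublist (x @ x) (morph u)"
      using square_in_image_of_short_word[OF sf square] short by blast
    then show False
      using \<open>x \<noteq> []\<close> by (auto simp: squarefree_word_def square_word_def)
  next
    case False
    moreover have "l \<le> n + 1"
      using sync(2) block_nonempty by linarith
    ultimately have "n dvd length x"
      using dvd_length_if_synchronizing[OF sync(1) _ sf square] by simp
    then show False
      using not_squarefree_word_if_morph_square_dvd[OF marked square \<open>x \<noteq> []\<close>] sf by blast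
  qed
qed

lemma borders_morph: "k \<in> borders w \<Longrightarrow> n * k \<in> borders (morph w)"
  using block_nonempty
  by (auto simp: borders_def take_morph drop_morph simp flip: diff_mult_distrib2)

lemma borders_block_subset_borders_morph:
  assumes "1 \<in> borders w"
  shows "borders (h (hd w)) \<subseteq> borders (morph w)"
proof -
  have "w \<noteq> []"
    using assms by (auto simp: borders_def)
  then have "take n (morph w) = h (hd w)"
    using take_morph[of 1 w] by (cases w) simp_all
  then show ?thesis
    using borders_take_border borders_morph[OF assms] by fastforce
qed

lemma card_borders_morph:
  assumes "1 \<in> borders w"
  shows "card (borders w) + card (borders (h (hd w))) \<le> card (borders (morph w))"
proof -
  have "(*) n ` borders w \<inter> borders (h (hd w)) = {}"
    by (auto simp: borders_def)
  moreover have "card ((*) n ` borders w) = card (borders w)"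
    using block_nonempty by (simp add: card_image inj_on_def)
  ultimately have "card (borders w) + card (borders (h (hd w)))
      = card ((*) n ` borders w \<union> borders (h (hd w)))"
    by (simp add: card_Un_disjoint)
  also have "\<dots> \<le> card (borders (morph w))"
    using borders_morph borders_block_subset_borders_morph[OF assms] by (intro card_mono) auto
  finally show ?thesis .
qed

end

section \<open>Leech's morphism\<close>

datatype letter = X | Y | Z

lemma UNIV_letter: "(UNIV :: letter set) = {X, Y, Z}"
  using letter.exhaust by blast

fun leech_block :: "letter \<Rightarrow> letter list" where
  "leech_block X = [X,Y,Z,Y,X,Z,Y,Z,X,Y,Z,Y,X]"
| "leech_block Y = [Y,Z,X,Z,Y,X,Z,X,Y,Z,X,Z,Y]"
| "leech_block Z = [Z,X,Y,X,Z,Y,X,Y,Z,X,Y,X,Z]"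

interpretation leech: uniform_morphism leech_block 13
proof
  show "length (leech_block a) = 13" for a
    by (cases a) simp_all
qed simp

lemma last_leech_block: "last (leech_block a) = a"
  by (cases a) simp_all

lemma borders_leech_block: "borders (leech_block a) = {1, 5}"
  by (cases a; hypsubst; code_simp)

definition short_squarefree_words :: "letter list list" where
  "short_squarefree_words =
     filter squarefree_word (concat (map (\<lambda>k. List.n_lists k [X, Y, Z]) [0..<3]))"

lemma short_squarefree_words_iff:
  "u \<in> set short_squarefree_words \<longleftrightarrow> squarefree_word u \<and> length u \<le> 2"
  by (auto simp: short_squarefree_words_def set_n_lists simp flip: UNIV_letter)

lemma squarefree_word_leech_short:
  assumes "squarefree_word u" and "length u \<le> 2"
  shows "squarefree_word (leech.morph u)"
proof -
  have "list_all (\<lambda>u. squarefree_word (leech.morph u)) short_squarefree_words"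
    by code_simp
  then show ?thesis
    using assms by (simp add: list_all_iff short_squarefree_words_iff)
qed

definition leech_windows :: "(nat \<times> letter list) list" where
  "leech_windows =
     [(r, take 8 (drop r (leech.morph u))). u \<leftarrow> short_squarefree_words,
        r \<leftarrow> [0..<min 13 (length (leech.morph u) - 7)]]"

lemma leech_windows_if_occurs_at_phase:
  assumes "leech.occurs_at_phase r x" and "length x = 8"
  shows "(r, x) \<in> set leech_windows"
proof -
  obtain u where u: "squarefree_word u" "length u \<le> 2" "r < 13"
    and x: "prefix x (drop r (leech.morph u))"
    using assms(1) by (auto simp: leech.occurs_at_phase_def)
  have "x = take 8 (drop r (leech.morph u))" "8 \<le> length (leech.morph u) - r"
    using x assms(2) prefix_length_le[OF x] by (auto simp: prefix_def)
  then show ?thesis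
    using u by (auto simp: leech_windows_def short_squarefree_words_iff simp del: leech.length_morph
        intro!: bexI[of _ u])
qed

lemma synchronizing_leech: "leech.synchronizing 8"
proof -
  have "distinct (map snd (remdups leech_windows))"
    by code_simp
  then have "inj_on snd (set leech_windows)"
    by (simp add: distinct_map)
  then have "r = s" if "(r, x) \<in> set leech_windows" "(s, x) \<in> set leech_windows" for r s x
    using that inj_onD[of snd "set leech_windows" "(r, x)" "(s, x)"] by simp
  then show ?thesis
    unfolding leech.synchronizing_def using leech_windows_if_occurs_at_phase by blast
qed

lemma squarefree_word_leech: "squarefree_word w \<Longrightarrow> squarefree_word (leech.morph w)"
  by (rule leech.squarefree_word_morph[OF synchronizing_leech])
    (simp_all add: last_leech_block squarefree_word_leech_short)

section \<open>Short words with many borders\<close>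

text \<open>The length condition is the bound of the theorem, multiplied by 12.\<close>

definition short_bordered_word :: "nat \<Rightarrow> letter list \<Rightarrow> bool" where
  "short_bordered_word p w \<longleftrightarrow> squarefree_word w \<and> 1 \<in> borders w \<and> p \<le> card (borders w) \<and>
     12 * length w \<le> 17 * 4 ^ (p - 1) + 4"

lemma one_in_borders_leech: "1 \<in> borders w \<Longrightarrow> 1 \<in> borders (leech.morph w)"
  using leech.borders_block_subset_borders_morph by (auto simp: borders_leech_block)

lemma card_borders_leech:
  "1 \<in> borders w \<Longrightarrow> card (borders w) + 2 \<le> card (borders (leech.morph w))"
  using leech.card_borders_morph[of w] by (simp add: borders_leech_block)

lemma short_bordered_word_leech:
  assumes "short_bordered_word p w" and "1 \<le> p"
  shows "short_bordered_word (p + 2) (leech.morph w)"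
proof -
  have w: "squarefree_word w" "1 \<in> borders w" "p \<le> card (borders w)"
    and len: "12 * length w \<le> 17 * 4 ^ (p - 1) + 4"
    using assms(1) by (simp_all only: short_bordered_word_def)
  have "p + 2 - 1 = (p - 1) + 2"
    using assms(2) by simp
  then have "(4 :: nat) ^ (p + 2 - 1) = 16 * 4 ^ (p - 1)"
    by (simp only: power_add) simp
  moreover have "(1 :: nat) \<le> 4 ^ (p - 1)"
    by simp
  ultimately have "12 * length (leech.morph w) \<le> 17 * 4 ^ (p + 2 - 1) + 4"
    using len unfolding leech.length_morph by linarith
  moreover have "p + 2 \<le> card (borders (leech.morph w))"
    using w(3) card_borders_leech[OF w(2)] by linarith
  ultimately show ?thesis
    using w squarefree_word_leech one_in_borders_leech by (simp only: short_bordered_word_def)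
qed

lemma short_bordered_word_3:
  "short_bordered_word 3 [X,Y,X,Z,Y,Z,X,Y,X,Z,Y,X,Y,Z,X,Y,X,Z,Y,Z,X,Y,X]"
  by code_simp

lemma short_bordered_word_4: "short_bordered_word 4 (leech.morph [X,Y,X,Z,X,Y,X])"
proof -
  define w where "w = [X,Y,X,Z,X,Y,X]"
  have "squarefree_word w" "1 \<in> borders w" "2 \<le> card (borders w)" "length w = 7"
    unfolding w_def by code_simp+
  then have "short_bordered_word 4 (leech.morph w)"
    using squarefree_word_leech[of w] one_in_borders_leech[of w] card_borders_leech[of w]
    by (simp add: short_bordered_word_def)
  then show ?thesis
    by (simp only: w_def)
qed

lemma exists_short_bordered_word: "\<exists>w. short_bordered_word (n + 3) w"
proof (induction n rule: induct_nat_012)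
  case 0
  show ?case
    using short_bordered_word_3 by auto
next
  case 1
  show ?case
    using short_bordered_word_4 by auto
next
  case (ge2 n)
  then obtain w where "short_bordered_word (n + 3) w"
    by blast
  then have "short_bordered_word (n + 3 + 2) (leech.morph w)"
    by (rule short_bordered_word_leech) simp
  then show ?case
    by (auto simp: add.commute)
qed

theorem theorem22:
  fixes A :: "'a set" and p :: nat
  assumes "card A = 3" and "p \<ge> 3"
  shows "squarefree_words_with_periods A p \<noteq> {} \<and>
         real (g A p) \<le> 17 / 12 * 4 ^ (p - 1) + 1 / 3"
proof -
  obtain w where w: "short_bordered_word p w"
    using exists_short_bordered_word[of "p - 3"] assms(2) by auto
  then have "w \<noteq> []"
    by (auto simp: short_bordered_word_def borders_def)
  then obtain v :: "letter list"
    where v: "v \<in> squarefree_words_with_periods UNIV p" "length v \<le> length w"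
    using exists_word_with_periods_if_many_borders[of w UNIV p] w
    by (auto simp: short_bordered_word_def)
  have "card (UNIV :: letter set) = card A" "finite (UNIV :: letter set)" "finite A"
    using assms(1) by (simp_all add: UNIV_letter card_ge_0_finite)
  then obtain f :: "letter \<Rightarrow> 'a" where "inj f" "range f = A"
    using finite_same_card_bij unfolding bij_betw_def by blast
  then have mem: "map f v \<in> squarefree_words_with_periods A p"
    using map_in_squarefree_words_with_periods v(1) by blast
  have "12 * g A p \<le> 17 * 4 ^ (p - 1) + 4"
    using g_le_length[OF mem] v(2) w by (simp add: short_bordered_word_def)
  then have "real (12 * g A p) \<le> real (17 * 4 ^ (p - 1) + 4)"
    by (rule of_nat_mono)
  then show ?thesis
    using mem by auto
qed

end
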